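(* Let $U\subset\mathcal{T}$ be a finite set of terms in $\mathbf{k}[x_1,\dots,x_n]$ with $x_1<\dots<x_n$, and let $\mathcal{B}$ be its Bar Code. Let $t\in U$, let $p=x_i^{k_i}\in NMP(t,U)$ be a nonmultiplicative power of $t$, and let $\mathcal{B}^{(i)}_j$ be the $i$-bar under $t$. Let $s\in U$. Then $s$ is a Janet-like divisor of $pt$ if and only if the following three conditions hold: (1) $s$ divides $pt$ (ordinary divisibility); (2) $s$ lies over $\mathcal{B}^{(i)}_{j+1}$; (3) for every $j'$ such that $x_{j'}$ divides $\frac{pt}{s}$, either there is a star immediately after the $j'$-bar under $s$, or the nonmultiplicative power of $s$ with respect to $x_{j'}$ has degree greater than $\deg_{j'}\!\left(\frac{pt}{s}\right)$.
   Context: $\mathcal{T}$ is the set of terms (monomials) $x_1^{\gamma_1}\cdots x_n^{\gamma_n}$, $\deg_h(t)$ is the exponent of $x_h$ in $t$, and $<$ is the lexicographic order induced by $x_1<\dots<x_n$ (compare exponents of $x_n$ first, then $x_{n-1}$, etc.). For a term $t=x_1^{\gamma_1}\cdots x_n^{\gamma_n}$ let $\pi^i(t)=x_i^{\gamma_i}\cdots x_n^{\gamma_n}$. Bar Code of $U$: order $U$ increasingly w.r.t. Lex as $t_1<\dots<t_m$; form the $n\times m$ matrix whose $(i,c)$ entry is $\pi^i(t_c)$. In row $i$, each maximal block of consecutive equal entries is underlined by a segment, called an $i$-bar; the $i$-bars are numbered $\mathcal{B}^{(i)}_1,\dots,\mathcal{B}^{(i)}_{\mu(i)}$ from left to right.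 A term $t_c$ lies over the $i$-bar whose segment covers column $c$ (the "$i$-bar under $t_c$"); each $i$-bar lies over a unique $(i+1)$-bar. Stars: for each $1\le i\le n$, a star is placed to the right of the last bar $\mathcal{B}^{(i)}_{\mu(i)}$; for each $1\le i\le n-1$ and $1\le j\le\mu(i)-1$, if $\mathcal{B}^{(i)}_j$ and $\mathcal{B}^{(i)}_{j+1}$ do not lie over the same $(i+1)$-bar, a star is placed between them. No other stars are placed. (A star after the $i$-bar under $s$ means exactly that $x_i$ is Janet-multiplicative for $s$, i.e. no $v\in U$ has $\deg_l(v)=\deg_l(s)$ for $l>i$ and $\deg_i(v)>\deg_i(s)$.) Janet-like nonmultiplicative powers: for $u\in U$ and $1\le i\le n$, let $h_i(u,U)=\max\{\deg_i(v): v\in U,\ \deg_l(v)=\deg_l(u)\ \forall l=i+1,\dots,n\}-\deg_i(u)$. If $h_i(u,U)>0$, set $k_i=\min\{\deg_i(v)-\deg_i(u): v\in U,\ \deg_l(v)=\deg_l(u)\ \forall l=i+1,\dots,n,\ \deg_i(v)>\deg_i(u)\}$; then $x_i^{k_i}$ is the nonmultiplicative power of $u$ with respect to $x_i$. $NMP(u,U)$ is the set of nonmultiplicative powers of $u$. Janet-like division: $NM(u,U)=\{v\in\mathcal{T}:\exists w\in NMP(u,U),\ w\mid v\}$ and $M(u,U)=\mathcal{T}\setminus NM(u,U)$. A term $u\in U$ is a Janet-like divisor of $w\in\mathcal{T}$ (written "$u\mid w$ w.r.t. Janet-like division") if $w=uv$ with $v\in M(u,U)$. *)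

theory Defs
  imports Complex_Main "HOL-Library.Poly_Mapping"
begin

text \<open>
  A term \<open>x\<^sub>1\<^bsup>\<gamma>\<^sub>1\<^esup> \<cdots> x\<^sub>n\<^bsup>\<gamma>\<^sub>n\<^esup>\<close> is represented by its exponent vector. The product of terms is
  therefore addition, the power \<open>x\<^sub>i\<^sup>k\<close> is \<^term>\<open>Poly_Mapping.single i k\<close>, and the quotient
  \<open>w / s\<close>, for \<open>s\<close> dividing \<open>w\<close>, is \<open>w - s\<close>.
\<close>

type_synonym pp = "nat \<Rightarrow>\<^sub>0 nat"

abbreviation pp_deg :: "nat \<Rightarrow> pp \<Rightarrow> nat" where
  "pp_deg i t \<equiv> Poly_Mapping.lookup t i"

definition pps :: "nat \<Rightarrow> pp set" where
  "pps n = {t. Poly_Mapping.keys t \<subseteq> {1..n}}"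

definition pp_dvd :: "pp \<Rightarrow> pp \<Rightarrow> bool" where
  "pp_dvd s w \<longleftrightarrow> (\<exists>v. w = s + v)"

text \<open>
  The instance \<^class>\<open>linorder\<close> of \<^type>\<open>poly_mapping\<close> compares the smallest differing index first,
  so it is not the order needed here.
\<close>

definition lex_less :: "pp \<Rightarrow> pp \<Rightarrow> bool" where
  "lex_less s t \<longleftrightarrow> (\<exists>i. pp_deg i s < pp_deg i t \<and> (\<forall>l>i. pp_deg l s = pp_deg l t))"

definition lex_le :: "pp \<Rightarrow> pp \<Rightarrow> bool" where
  "lex_le s t \<longleftrightarrow> s = t \<or> lex_less s t"

lemma lex_less_irrefl: "\<not> lex_less s s"
  by (simp add: lex_less_def)

lemma lex_less_trans:
  assumes "lex_less s t" "lex_less t u"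
  shows "lex_less s u"
proof -
  obtain i where i: "pp_deg i s < pp_deg i t" "\<forall>l>i. pp_deg l s = pp_deg l t"
    using assms(1) by (auto simp: lex_less_def)
  obtain j where j: "pp_deg j t < pp_deg j u" "\<forall>l>j. pp_deg l t = pp_deg l u"
    using assms(2) by (auto simp: lex_less_def)
  have "pp_deg (max i j) s < pp_deg (max i j) u"
    using i j by (cases i j rule: linorder_cases) (auto simp: max_def)
  moreover have "\<forall>l>max i j. pp_deg l s = pp_deg l u"
    using i j by simp
  ultimately show ?thesis
    unfolding lex_less_def by blast
qed

lemma lex_less_total:
  assumes "s \<noteq> t"
  shows "lex_less s t \<or> lex_less t s"
proof -
  define D where "D = {l. pp_deg l s \<noteq> pp_deg l t}"
  have "D \<subseteq> Poly_Mapping.keys s \<union> Poly_Mapping.keys t"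
    by (auto simp: D_def in_keys_iff)
  then have fin: "finite D"
    by (rule finite_subset) simp
  have "D \<noteq> {}"
    using assms by (auto simp: D_def intro: poly_mapping_eqI)
  then have "Max D \<in> D"
    using fin by simp
  moreover have "\<forall>l>Max D. pp_deg l s = pp_deg l t"
    using Max_ge[OF fin] by (auto simp: D_def simp flip: not_le)
  ultimately show ?thesis
    unfolding lex_less_def D_def by (metis (mono_tags, lifting) mem_Collect_eq nat_neq_iff)
qed

interpretation lex: linorder lex_le lex_less
proof
  fix s t u :: pp
  show "lex_less s t \<longleftrightarrow> lex_le s t \<and> \<not> lex_le t s"
    using lex_less_irrefl lex_less_trans by (auto simp: lex_le_def)
  show "lex_le s s"
    by (simp add: lex_le_def)
  show "lex_le s t \<Longrightarrow> lex_le t u \<Longrightarrow> lex_le s u"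
    using lex_less_trans by (auto simp: lex_le_def)
  show "lex_le s t \<Longrightarrow> lex_le t s \<Longrightarrow> s = t"
    using lex_less_irrefl lex_less_trans by (auto simp: lex_le_def)
  show "lex_le s t \<or> lex_le t s"
    using lex_less_total by (auto simp: lex_le_def)
qed

text \<open>\<open>pp_tail i t\<close> is \<open>\<pi>\<^sup>i(t) = x\<^sub>i\<^bsup>\<gamma>\<^sub>i\<^esup> \<cdots> x\<^sub>n\<^bsup>\<gamma>\<^sub>n\<^esup>\<close>.\<close>

lift_definition pp_tail :: "nat \<Rightarrow> pp \<Rightarrow> pp" is "\<lambda>i t l. if i \<le> l then t l else 0"
  by (erule rev_finite_subset) auto

text \<open>
  The columns of the Bar Code are numbered from \<open>0\<close>, the rows from \<open>1\<close>. A bar is represented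
  by the set of columns that its segment covers.
\<close>

definition bc_terms :: "pp set \<Rightarrow> pp list" where
  "bc_terms U = lex.sorted_list_of_set U"

definition bc_entry :: "pp set \<Rightarrow> nat \<Rightarrow> nat \<Rightarrow> pp" where
  "bc_entry U i c = pp_tail i (bc_terms U ! c)"

definition is_bar :: "pp set \<Rightarrow> nat \<Rightarrow> nat set \<Rightarrow> bool" where
  "is_bar U i B \<longleftrightarrow> (\<exists>a b. a \<le> b \<and> b < length (bc_terms U) \<and> B = {a..b} \<and>
     (\<forall>c\<in>{a..b}. bc_entry U i c = bc_entry U i a) \<and>
     (0 < a \<longrightarrow> bc_entry U i (a - 1) \<noteq> bc_entry U i a) \<and>
     (b + 1 < length (bc_terms U) \<longrightarrow> bc_entry U i (b + 1) \<noteq> bc_entry U i b))"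

definition bar_list :: "pp set \<Rightarrow> nat \<Rightarrow> nat set list" where
  "bar_list U i = sorted_key_list_of_set Min {B. is_bar U i B}"

text \<open>\<open>num_bars U i\<close> is \<open>\<mu>(i)\<close>, and the \<open>i\<close>-bars are \<open>bar U i 1, \<dots>, bar U i \<mu>(i)\<close>.\<close>

definition num_bars :: "pp set \<Rightarrow> nat \<Rightarrow> nat" where
  "num_bars U i = length (bar_list U i)"

definition bar :: "pp set \<Rightarrow> nat \<Rightarrow> nat \<Rightarrow> nat set" where
  "bar U i j = bar_list U i ! (j - 1)"

definition term_over_bar :: "pp set \<Rightarrow> pp \<Rightarrow> nat \<Rightarrow> nat \<Rightarrow> bool" where
  "term_over_bar U t i j \<longleftrightarrow>
     j \<in> {1..num_bars U i} \<and> (\<exists>c\<in>bar U i j. bc_terms U ! c = t)"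

definition same_bar_below :: "pp set \<Rightarrow> nat \<Rightarrow> nat \<Rightarrow> nat \<Rightarrow> bool" where
  "same_bar_below U i j j' \<longleftrightarrow>
     (\<exists>m\<in>{1..num_bars U (i + 1)}. bar U i j \<subseteq> bar U (i + 1) m \<and> bar U i j' \<subseteq> bar U (i + 1) m)"

text \<open>There is a star immediately after the bar \<open>bar U i j\<close>.\<close>

definition star_after :: "nat \<Rightarrow> pp set \<Rightarrow> nat \<Rightarrow> nat \<Rightarrow> bool" where
  "star_after n U i j \<longleftrightarrow>
     i \<in> {1..n} \<and> j \<in> {1..num_bars U i} \<and>
     (j = num_bars U i \<or> (i < n \<and> \<not> same_bar_below U i j (j + 1)))"

definition janet_class :: "nat \<Rightarrow> pp set \<Rightarrow> pp \<Rightarrow> nat \<Rightarrow> pp set" where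
  "janet_class n U u i = {v \<in> U. \<forall>l\<in>{i + 1..n}. pp_deg l v = pp_deg l u}"

text \<open>For \<open>u \<in> U\<close> with \<open>U\<close> finite, the subtraction on natural numbers is not truncated.\<close>

definition nm_height :: "nat \<Rightarrow> pp set \<Rightarrow> pp \<Rightarrow> nat \<Rightarrow> nat" where
  "nm_height n U u i = Max {pp_deg i v | v. v \<in> janet_class n U u i} - pp_deg i u"

text \<open>The exponent \<open>k\<^sub>i\<close>; it is meaningful only if \<open>nm_height n U u i > 0\<close>.\<close>

definition nm_exp :: "nat \<Rightarrow> pp set \<Rightarrow> pp \<Rightarrow> nat \<Rightarrow> nat" where
  "nm_exp n U u i =
     Min {pp_deg i v - pp_deg i u | v. v \<in> janet_class n U u i \<and> pp_deg i v > pp_deg i u}"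

definition NMP :: "nat \<Rightarrow> pp set \<Rightarrow> pp \<Rightarrow> pp set" where
  "NMP n U u =
     {Poly_Mapping.single i (nm_exp n U u i) | i. i \<in> {1..n} \<and> nm_height n U u i > 0}"

definition NM :: "nat \<Rightarrow> pp set \<Rightarrow> pp \<Rightarrow> pp set" where
  "NM n U u = {v \<in> pps n. \<exists>w\<in>NMP n U u. pp_dvd w v}"

definition M :: "nat \<Rightarrow> pp set \<Rightarrow> pp \<Rightarrow> pp set" where
  "M n U u = pps n - NM n U u"

definition janet_like_divisor :: "nat \<Rightarrow> pp set \<Rightarrow> pp \<Rightarrow> pp \<Rightarrow> bool" where
  "janet_like_divisor n U u w \<longleftrightarrow> u \<in> U \<and> (\<exists>v\<in>M n U u. w = u + v)"

end

theory Submission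
  imports Defs
begin

text \<open>
  The \<open>i\<close>-bars correspond to the distinct tails \<open>\<pi>\<^sup>i(u)\<close>, \<open>u \<in> U\<close>, ordered lexicographically. Hence
  there is a star after the \<open>i\<close>-bar under \<open>s\<close> iff \<open>s\<close> has no nonmultiplicative power of \<open>x\<^sub>i\<close>, and
  conditions (1) and (3) together say exactly that \<open>s\<close> is a Janet-like divisor of \<open>pt\<close>. It remains
  to see that they imply (2). Some \<open>v \<in> U\<close> has \<open>\<pi>\<^sup>i(v) = \<pi>\<^sup>i(pt)\<close>, and it lies over the bar
  following the one under \<open>t\<close>. If \<open>s\<close> and \<open>pt\<close> differed in an exponent of index at least \<open>i\<close>, then,
  at the largest such index \<open>l\<close>, the term \<open>v\<close> would show that the nonmultiplicative power of \<open>s\<close>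
  with respect to \<open>x\<^sub>l\<close> divides \<open>pt/s\<close>.
\<close>

section \<open>Tails\<close>

lemma lookup_pp_tail: "pp_deg l (pp_tail i t) = (if i \<le> l then pp_deg l t else 0)"
  by transfer simp

lemma pp_tail_eq_iff: "pp_tail i s = pp_tail i t \<longleftrightarrow> (\<forall>l\<ge>i. pp_deg l s = pp_deg l t)"
  by (auto simp: poly_mapping_eq_iff fun_eq_iff lookup_pp_tail)

text \<open>Below \<open>i\<close> both tails have exponent 0, so the index that decides their
  comparison is at least \<open>i\<close>, where tails and terms agree.\<close>

lemma lex_less_pp_tail_iff:
  "lex_less (pp_tail i s) (pp_tail i t) \<longleftrightarrow>
     (\<exists>k\<ge>i. pp_deg k s < pp_deg k t \<and> (\<forall>l>k. pp_deg l s = pp_deg l t))"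
proof
  assume "lex_less (pp_tail i s) (pp_tail i t)"
  then obtain k where k: "pp_deg k (pp_tail i s) < pp_deg k (pp_tail i t)"
    "\<And>l. l > k \<Longrightarrow> pp_deg l (pp_tail i s) = pp_deg l (pp_tail i t)"
    unfolding lex_less_def by blast
  then have "i \<le> k"
    by (simp add: lookup_pp_tail split: if_splits)
  with k have "pp_deg k s < pp_deg k t" "\<forall>l>k. pp_deg l s = pp_deg l t"
    by (auto simp: lookup_pp_tail)
  with \<open>i \<le> k\<close> show "\<exists>k\<ge>i. pp_deg k s < pp_deg k t \<and> (\<forall>l>k. pp_deg l s = pp_deg l t)"
    by blast
next
  assume "\<exists>k\<ge>i. pp_deg k s < pp_deg k t \<and> (\<forall>l>k. pp_deg l s = pp_deg l t)"
  then obtain k where "k \<ge> i" "pp_deg k s < pp_deg k t" "\<forall>l>k. pp_deg l s = pp_deg l t"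
    by blast
  then show "lex_less (pp_tail i s) (pp_tail i t)"
    unfolding lex_less_def by (intro exI[of _ k]) (simp add: lookup_pp_tail)
qed

lemma lex_less_pp_tailD: "lex_less (pp_tail i s) (pp_tail i t) \<Longrightarrow> lex_less s t"
  unfolding lex_less_pp_tail_iff unfolding lex_less_def by blast

lemma pp_tail_mono: "lex_le s t \<Longrightarrow> lex_le (pp_tail i s) (pp_tail i t)"
  using lex_less_pp_tailD lex.not_le by blast

text \<open>Strictness can be lost because the deciding index may be \<open>i\<close> itself. The
  lemma serves to squeeze tails from \<open>Suc i\<close> on between two equal ones.\<close>

lemma lex_less_pp_tail_Suc:
  "lex_less (pp_tail i s) (pp_tail i t) \<Longrightarrow> lex_le (pp_tail (Suc i) s) (pp_tail (Suc i) t)"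
  using lex_less_pp_tailD lex.less_imp_le pp_tail_mono by blast

text \<open>Once the exponents above \<open>i\<close> agree, only \<open>i\<close> can decide. This
  turns comparisons of bars into the degree comparisons behind \<open>nm_height\<close> and
  \<open>nm_exp\<close>.\<close>

lemma lex_less_pp_tail_iff_deg:
  assumes "pp_tail (Suc i) s = pp_tail (Suc i) t"
  shows "lex_less (pp_tail i s) (pp_tail i t) \<longleftrightarrow> pp_deg i s < pp_deg i t"
proof
  assume "lex_less (pp_tail i s) (pp_tail i t)"
  then obtain k where "k \<ge> i" "pp_deg k s < pp_deg k t"
    unfolding lex_less_pp_tail_iff by blast
  moreover have "\<not> Suc i \<le> k"
    using assms calculation(2) unfolding pp_tail_eq_iff by force
  ultimately show "pp_deg i s < pp_deg i t"
    by (metis le_antisym not_less_eq_eq)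
next
  assume "pp_deg i s < pp_deg i t"
  then show "lex_less (pp_tail i s) (pp_tail i t)"
    using assms unfolding lex_less_pp_tail_iff pp_tail_eq_iff by (auto simp: Suc_le_eq)
qed

section \<open>Bars\<close>

lemma set_bc_terms: "finite U \<Longrightarrow> set (bc_terms U) = U"
  by (simp add: bc_terms_def)

lemma bc_terms_nth_mono:
  assumes "c \<le> d" "d < length (bc_terms U)"
  shows "lex_le (bc_terms U ! c) (bc_terms U ! d)"
proof -
  have "sorted_wrt lex_less (bc_terms U)"
    using lex.strict_sorted_list_of_set[of U] by (simp add: bc_terms_def)
  then show ?thesis
    using assms by (cases "c = d") (auto simp: sorted_wrt_iff_nth_less lex_le_def)
qed

lemma bc_entry_mono:
  "c \<le> d \<Longrightarrow> d < length (bc_terms U) \<Longrightarrow> lex_le (bc_entry U i c) (bc_entry U i d)"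
  unfolding bc_entry_def by (intro pp_tail_mono bc_terms_nth_mono)

text \<open>The entries increase weakly along a row, so a column between two equal entries is
  squeezed. Level sets of a row are therefore intervals.\<close>

lemma bc_entry_eq_between:
  assumes "a \<le> c" "c \<le> b" "b < length (bc_terms U)" "bc_entry U i a = bc_entry U i b"
  shows "bc_entry U i c = bc_entry U i b"
  using bc_entry_mono[of a c U i] bc_entry_mono[of c b U i] assms lex.order.antisym by simp

text \<open>A level set of row \<open>i\<close>, with no reference to endpoints or maximality; it is
  empty if \<open>x\<close> is not the tail of a term of \<open>U\<close>.\<close>

definition tail_block :: "pp set \<Rightarrow> nat \<Rightarrow> pp \<Rightarrow> nat set" where
  "tail_block U i x = {c. c < length (bc_terms U) \<and> bc_entry U i c = x}"

lemma finite_tail_block: "finite (tail_block U i x)"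
  by (simp add: tail_block_def)

lemma tail_block_nonempty:
  assumes "finite U" "u \<in> U"
  shows "tail_block U i (pp_tail i u) \<noteq> {}"
proof -
  obtain c where "c < length (bc_terms U)" "bc_terms U ! c = u"
    using assms set_bc_terms in_set_conv_nth by metis
  then show ?thesis
    by (auto simp: tail_block_def bc_entry_def)
qed

text \<open>Since level sets are intervals, a maximal constant run exhausts its level set. From here
  on endpoints of bars can be forgotten.\<close>

lemma is_bar_iff_tail_block:
  assumes "finite U"
  shows "is_bar U i B \<longleftrightarrow> (\<exists>u\<in>U. B = tail_block U i (pp_tail i u))"
proof
  assume "is_bar U i B"
  then obtain a b where ab: "a \<le> b" "b < length (bc_terms U)" "B = {a..b}"
     "\<forall>c\<in>{a..b}. bc_entry U i c = bc_entry U i a"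
     "0 < a \<longrightarrow> bc_entry U i (a - 1) \<noteq> bc_entry U i a"
     "b + 1 < length (bc_terms U) \<longrightarrow> bc_entry U i (b + 1) \<noteq> bc_entry U i b"
    unfolding is_bar_def by blast
  have eq: "bc_entry U i b = bc_entry U i a"
    by (rule bspec[OF ab(4)]) (simp add: ab(1))
  \<comment> \<open>An equal entry outside the run would, by squeezing, make the entry adjacent to
    the run equal too, against maximality.\<close>
  have "c \<in> {a..b}" if c: "c < length (bc_terms U)" "bc_entry U i c = bc_entry U i a" for c
  proof (rule ccontr)
    assume "c \<notin> {a..b}"
    then have "c < a \<or> b < c" by auto
    then show False
    proof
      assume "c < a"
      then show False
        using bc_entry_eq_between[of c "a - 1" a U i] ab(1,2,5) c by simp
    next
      assume "b < c"
      then show False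
        using bc_entry_eq_between[of b "b + 1" c U i] ab(6) c eq by simp
    qed
  qed
  moreover have "c < length (bc_terms U) \<and> bc_entry U i c = bc_entry U i a" if "c \<in> {a..b}" for c
    using bspec[OF ab(4) that] that ab(2) by simp
  ultimately have "B = tail_block U i (bc_entry U i a)"
    unfolding ab(3) tail_block_def by blast
  moreover have "bc_terms U ! a \<in> U"
    using ab(1,2) set_bc_terms[OF assms] nth_mem[of a "bc_terms U"] by simp
  ultimately show "\<exists>u\<in>U. B = tail_block U i (pp_tail i u)"
    unfolding bc_entry_def by blast
next
  assume "\<exists>u\<in>U. B = tail_block U i (pp_tail i u)"
  then obtain u where u: "u \<in> U" "B = tail_block U i (pp_tail i u)" by blast
  have fin: "finite B" and ne: "B \<noteq> {}"
    using u assms tail_block_nonempty finite_tail_block by auto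
  define a b where "a = Min B" and "b = Max B"
  have mem: "a \<in> B" "b \<in> B" and bounds: "\<And>c. c \<in> B \<Longrightarrow> a \<le> c \<and> c \<le> b"
    using fin ne by (auto simp: a_def b_def)
  have B: "c \<in> B \<longleftrightarrow> c < length (bc_terms U) \<and> bc_entry U i c = pp_tail i u" for c
    by (simp add: u tail_block_def)
  have Bab: "B = {a..b}"
  proof
    show "B \<subseteq> {a..b}"
      using bounds by (meson atLeastAtMost_iff subsetI)
    show "{a..b} \<subseteq> B"
    proof
      fix c
      assume "c \<in> {a..b}"
      then show "c \<in> B"
        using mem bc_entry_eq_between[of a c b U i] unfolding B by simp
    qed
  qed
  have left: "a - 1 \<notin> B" if "0 < a"
    using bounds[of "a - 1"] that by linarith
  have right: "b + 1 \<notin> B"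
    using bounds[of "b + 1"] by linarith
  show "is_bar U i B"
    unfolding is_bar_def
  proof (rule exI[of _ a], rule exI[of _ b], intro conjI impI ballI)
    show "bc_entry U i c = bc_entry U i a" if "c \<in> {a..b}" for c
      using that mem(1) B unfolding Bab[symmetric] by simp
    show "a \<le> b" using bounds[OF mem(2)] ..
    show "b < length (bc_terms U)" using mem(2) unfolding B ..
    show "B = {a..b}" by (rule Bab)
    show "bc_entry U i (a - 1) \<noteq> bc_entry U i a" if "0 < a"
      using left[OF that] mem(1) unfolding B by auto
    show "bc_entry U i (b + 1) \<noteq> bc_entry U i b" if "b + 1 < length (bc_terms U)"
      using right mem(2) that unfolding B by simp
  qed
qed

text \<open>A smaller tail cannot first occur at or after the first column of a larger one, because
  rows increase. The converse follows by exchanging the roles and by linearity.\<close>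

lemma Min_tail_block_less_iff:
  assumes "finite U" "u \<in> U" "v \<in> U"
  shows "Min (tail_block U i (pp_tail i u)) < Min (tail_block U i (pp_tail i v)) \<longleftrightarrow>
    lex_less (pp_tail i u) (pp_tail i v)"
proof -
  have mem: "Min (tail_block U i (pp_tail i w)) \<in> tail_block U i (pp_tail i w)" if "w \<in> U" for w
    using that assms(1) finite_tail_block tail_block_nonempty by simp
  have *: "lex_less (pp_tail i w) (pp_tail i w') \<Longrightarrow>
      Min (tail_block U i (pp_tail i w)) < Min (tail_block U i (pp_tail i w'))"
    if "w \<in> U" "w' \<in> U" for w w'
    using mem[OF that(1)] mem[OF that(2)] unfolding tail_block_def
    by (smt (verit) bc_entry_mono lex.not_le linorder_not_less mem_Collect_eq)
  show ?thesis
    using *[OF assms(2,3)] *[OF assms(3,2)] lex.less_linear[of "pp_tail i u" "pp_tail i v"] by auto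
qed

text \<open>The locale needs a carrier on which the key is injective. Choosing \<open>A\<close>
  itself as carrier allows the key \<open>Min\<close>, which is injective on bars but not on all
  sets of columns.\<close>

lemma (in linorder)
  assumes "inj_on f A"
  shows set_sorted_key_list_of_set_inj_on: "finite A \<Longrightarrow> set (sorted_key_list_of_set f A) = A"
    and strict_sorted_key_list_of_set_inj_on: "sorted_wrt (<) (map f (sorted_key_list_of_set f A))"
proof -
  interpret folding_insort_key "(\<le>)" "(<)" A f
    by unfold_locales (rule assms)
  show "finite A \<Longrightarrow> set (sorted_key_list_of_set f A) = A"
    by (rule set_sorted_key_list_of_set) simp_all
  show "sorted_wrt (<) (map f (sorted_key_list_of_set f A))"
    by (rule strict_sorted_key_list_of_set) simp
qed

lemma
  assumes "finite U"
  shows set_bar_list: "set (bar_list U i) = {B. is_bar U i B}"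
    and bar_list_strict_sorted: "sorted_wrt (<) (map Min (bar_list U i))"
proof -
  have eq: "{B. is_bar U i B} = (\<lambda>u. tail_block U i (pp_tail i u)) ` U"
    using is_bar_iff_tail_block[OF assms] by blast
  have inj: "inj_on Min {B. is_bar U i B}"
  proof (rule inj_onI)
    fix B B'
    assume BB': "B \<in> {B. is_bar U i B}" "B' \<in> {B. is_bar U i B}" "Min B = Min B'"
    obtain u v where uv: "u \<in> U" "v \<in> U"
      "B = tail_block U i (pp_tail i u)" "B' = tail_block U i (pp_tail i v)"
      using BB'(1,2) unfolding eq by (elim imageE)
    \<comment> \<open>Equal leftmost columns rule out both strict orders between the tails.\<close>
    then have "pp_tail i u = pp_tail i v"
      using BB'(3) Min_tail_block_less_iff[OF assms uv(1,2), of i]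
        Min_tail_block_less_iff[OF assms uv(2,1), of i]
        lex.less_linear[of "pp_tail i u" "pp_tail i v"] by auto
    then show "B = B'"
      using uv by simp
  qed
  have "finite {B. is_bar U i B}"
    unfolding eq using assms by simp
  then show "set (bar_list U i) = {B. is_bar U i B}"
    unfolding bar_list_def by (rule set_sorted_key_list_of_set_inj_on[OF inj])
  show "sorted_wrt (<) (map Min (bar_list U i))"
    unfolding bar_list_def by (rule strict_sorted_key_list_of_set_inj_on[OF inj])
qed

section \<open>Terms over numbered bars\<close>

lemma term_over_barD:
  assumes "finite U" "term_over_bar U u i b"
  shows "1 \<le> b" "b \<le> num_bars U i" "u \<in> U" "bar U i b = tail_block U i (pp_tail i u)"
proof -
  obtain c where b: "1 \<le> b" "b \<le> num_bars U i" and c: "c \<in> bar U i b" "bc_terms U ! c = u"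
    using assms(2) unfolding term_over_bar_def by auto
  then have "bar U i b \<in> set (bar_list U i)"
    by (auto simp: bar_def num_bars_def)
  then obtain v where v: "v \<in> U" "bar U i b = tail_block U i (pp_tail i v)"
    using set_bar_list[OF assms(1)] is_bar_iff_tail_block[OF assms(1)] by auto
  \<comment> \<open>The bar is the level set of some tail; the column of \<open>u\<close> inside it
    identifies this tail as that of \<open>u\<close>.\<close>
  have "c < length (bc_terms U)" "pp_tail i v = pp_tail i u"
    using c v by (auto simp: tail_block_def bc_entry_def)
  then show "u \<in> U" "bar U i b = tail_block U i (pp_tail i u)"
    using c v set_bc_terms[OF assms(1)] nth_mem by auto
  show "1 \<le> b" "b \<le> num_bars U i" by fact+
qed

lemma ex_term_over_bar:
  assumes "finite U" "b \<in> {1..num_bars U i}"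
  shows "\<exists>u. term_over_bar U u i b"
proof -
  have "bar U i b \<in> set (bar_list U i)"
    using assms(2) by (auto simp: bar_def num_bars_def)
  then obtain v where "v \<in> U" "bar U i b = tail_block U i (pp_tail i v)"
    using set_bar_list[OF assms(1)] is_bar_iff_tail_block[OF assms(1)] by auto
  then have "bar U i b \<noteq> {}"
    using tail_block_nonempty assms by simp
  then show ?thesis
    using assms(2) by (auto simp: term_over_bar_def)
qed

lemma ex_bar_under:
  assumes "finite U" "u \<in> U"
  shows "\<exists>b. term_over_bar U u i b"
proof -
  obtain k where k: "k < length (bar_list U i)" "bar_list U i ! k = tail_block U i (pp_tail i u)"
    using is_bar_iff_tail_block[OF assms(1)] set_bar_list[OF assms(1), of i] assms(2)
    by (metis (mono_tags, lifting) in_set_conv_nth mem_Collect_eq)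
  obtain c where c: "c < length (bc_terms U)" "bc_terms U ! c = u"
    using assms set_bc_terms in_set_conv_nth by metis
  \<comment> \<open>Bars are numbered from 1, list positions from 0.\<close>
  have "term_over_bar U u i (Suc k)"
    using k c by (auto simp: term_over_bar_def num_bars_def bar_def tail_block_def bc_entry_def)
  then show ?thesis ..
qed

text \<open>Bars are listed by strictly increasing leftmost column, and leftmost columns are ordered
  like the tails.\<close>

lemma bar_index_less_iff:
  assumes "finite U" "term_over_bar U u i a" "term_over_bar U v i b"
  shows "a < b \<longleftrightarrow> lex_less (pp_tail i u) (pp_tail i v)"
proof -
  note u = term_over_barD[OF assms(1,2)] and v = term_over_barD[OF assms(1,3)]
  have mono: "Min (bar U i k) < Min (bar U i l)" if "1 \<le> k" "k < l" "l \<le> num_bars U i" for k l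
    using bar_list_strict_sorted[OF assms(1), of i] that
    by (auto simp: sorted_wrt_iff_nth_less bar_def num_bars_def)
  have "a < b \<longleftrightarrow> Min (bar U i a) < Min (bar U i b)"
    using mono[of a b] mono[of b a] u(1,2) v(1,2) by (cases a b rule: linorder_cases) auto
  then show ?thesis
    using Min_tail_block_less_iff[OF assms(1) u(3) v(3)] u(4) v(4) by simp
qed

text \<open>If the bar under \<open>v\<close> came later than \<open>Suc b\<close>, a term over bar
  \<open>Suc b\<close> would have its tail strictly between those of \<open>u\<close> and
  \<open>v\<close>, which \<open>gap\<close> forbids.\<close>

lemma term_over_bar_Suc:
  assumes "finite U" "term_over_bar U u i b" "v \<in> U"
    and less: "lex_less (pp_tail i u) (pp_tail i v)"
    and gap: "\<And>w. w \<in> U \<Longrightarrow> lex_less (pp_tail i u) (pp_tail i w) \<Longrightarrow>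
      \<not> lex_less (pp_tail i w) (pp_tail i v)"
  shows "term_over_bar U v i (Suc b)"
proof -
  obtain b' where b': "term_over_bar U v i b'"
    using ex_bar_under assms by blast
  have "b < b'"
    using bar_index_less_iff[OF assms(1,2) b'] less by simp
  moreover have "\<not> Suc b < b'"
  proof
    assume *: "Suc b < b'"
    then obtain w where w: "term_over_bar U w i (Suc b)"
      using ex_term_over_bar[OF assms(1), of "Suc b" i] term_over_barD(2)[OF assms(1) b'] by auto
    show False
      using gap[of w] bar_index_less_iff[OF assms(1,2) w] bar_index_less_iff[OF assms(1) w b'] *
        term_over_barD(3)[OF assms(1) w] by simp
  qed
  ultimately show ?thesis
    using b' by (metis Suc_lessI)
qed

text \<open>Equal tails from \<open>i\<close> on are equal from \<open>Suc i\<close> on, so each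
  \<open>i\<close>-bar sits inside a single bar of the next row, the level set of the shorter
  tail.\<close>

lemma same_bar_below_iff:
  assumes "finite U" "term_over_bar U u i a" "term_over_bar U v i b"
  shows "same_bar_below U i a b \<longleftrightarrow> pp_tail (Suc i) u = pp_tail (Suc i) v"
proof
  note u = term_over_barD[OF assms(1,2)] and v = term_over_barD[OF assms(1,3)]
  obtain c d where c: "c \<in> bar U i a" "bc_terms U ! c = u" and d: "d \<in> bar U i b" "bc_terms U ! d = v"
    using assms(2,3) by (auto simp: term_over_bar_def)
  {
    assume "same_bar_below U i a b"
    then obtain m where m: "m \<in> {1..num_bars U (Suc i)}"
      "bar U i a \<subseteq> bar U (Suc i) m" "bar U i b \<subseteq> bar U (Suc i) m"
      by (auto simp: same_bar_below_def)
    then have "term_over_bar U u (Suc i) m" "term_over_bar U v (Suc i) m"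
      using c d by (auto simp: term_over_bar_def)
    then have "c \<in> tail_block U (Suc i) (pp_tail (Suc i) v)"
      using term_over_barD(4)[OF assms(1)] c m by blast
    then show "pp_tail (Suc i) u = pp_tail (Suc i) v"
      using c by (simp add: tail_block_def bc_entry_def)
  }
  assume eq: "pp_tail (Suc i) u = pp_tail (Suc i) v"
  obtain m where m: "term_over_bar U u (Suc i) m"
    using ex_bar_under[OF assms(1) u(3)] by blast
  have "tail_block U i (pp_tail i w) \<subseteq> tail_block U (Suc i) (pp_tail (Suc i) w)" for w
    by (auto simp: tail_block_def bc_entry_def pp_tail_eq_iff)
  then show "same_bar_below U i a b"
    using u(4) v(4) eq term_over_barD(1,2,4)[OF assms(1) m]
    unfolding same_bar_below_def by (intro bexI[of _ m]) force+
qed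

section \<open>Nonmultiplicative powers\<close>

text \<open>The class compares exponents only up to \<open>n\<close>, a tail compares all of them;
  in \<open>U\<close> the exponents beyond \<open>n\<close> vanish.\<close>

lemma in_janet_class_iff:
  assumes "U \<subseteq> pps n" "u \<in> U"
  shows "v \<in> janet_class n U u i \<longleftrightarrow> v \<in> U \<and> pp_tail (Suc i) v = pp_tail (Suc i) u"
proof -
  have "pp_deg l w = 0" if "w \<in> U" "n < l" for w l
    using assms(1) that by (force simp: pps_def in_keys_iff)
  then show ?thesis
    using assms(2) by (auto simp: janet_class_def pp_tail_eq_iff Suc_le_eq)
qed

lemma nm_height_pos_iff:
  assumes "finite U" "u \<in> U"
  shows "nm_height n U u i > 0 \<longleftrightarrow> (\<exists>v\<in>janet_class n U u i. pp_deg i u < pp_deg i v)"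
proof -
  have "finite (janet_class n U u i)" "u \<in> janet_class n U u i"
    using assms by (auto simp: janet_class_def)
  then have "pp_deg i u < Max (pp_deg i ` janet_class n U u i) \<longleftrightarrow>
      (\<exists>v\<in>janet_class n U u i. pp_deg i u < pp_deg i v)"
    by (subst Max_gr_iff) auto
  then show ?thesis
    by (simp add: nm_height_def setcompr_eq_image)
qed

lemma nm_exp_le:
  assumes "finite U" "v \<in> janet_class n U u i" "pp_deg i u < pp_deg i v"
  shows "nm_exp n U u i \<le> pp_deg i v - pp_deg i u"
proof -
  have "finite (janet_class n U u i)"
    using assms(1) by (simp add: janet_class_def)
  then show ?thesis
    unfolding nm_exp_def using assms by (intro Min_le) auto
qed

text \<open>Positive height makes the set of gaps nonempty, so its \<open>Min\<close> is one of its
  elements.\<close>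

lemma nm_exp_attained:
  assumes "finite U" "u \<in> U" "nm_height n U u i > 0"
  obtains v where "v \<in> janet_class n U u i" "pp_deg i u < pp_deg i v"
    "nm_exp n U u i = pp_deg i v - pp_deg i u"
proof -
  let ?S = "{pp_deg i v - pp_deg i u | v. v \<in> janet_class n U u i \<and> pp_deg i v > pp_deg i u}"
  have "finite (janet_class n U u i)"
    using assms(1) by (simp add: janet_class_def)
  then have "finite ?S" by simp
  moreover obtain w where "w \<in> janet_class n U u i" "pp_deg i u < pp_deg i w"
    using assms(3) unfolding nm_height_pos_iff[OF assms(1,2)] by blast
  then have "?S \<noteq> {}" by auto
  ultimately have "nm_exp n U u i \<in> ?S"
    unfolding nm_exp_def by (rule Min_in)
  then show thesis
    using that by blast
qed

text \<open>Positive height means that some term of \<open>U\<close> has the same tail from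
  \<open>Suc i\<close> on and a larger tail from \<open>i\<close> on. If such a term exists, one
  over the next bar \<open>b + 1\<close> already has this property, by squeezing; and whether it
  does is what a star after a bar other than the last one records.\<close>

lemma star_after_iff_nm_height:
  assumes "finite U" "U \<subseteq> pps n" "i \<in> {1..n}" "term_over_bar U s i b"
  shows "star_after n U i b \<longleftrightarrow> nm_height n U s i = 0"
proof -
  note s = term_over_barD[OF assms(1,4)]
  have height: "nm_height n U s i > 0 \<longleftrightarrow> (\<exists>v\<in>U. pp_tail (Suc i) s = pp_tail (Suc i) v \<and>
      lex_less (pp_tail i s) (pp_tail i v))"
    unfolding nm_height_pos_iff[OF assms(1) s(3)] Bex_def in_janet_class_iff[OF assms(2) s(3)]
    using lex_less_pp_tail_iff_deg by metis
  show ?thesis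
  proof (cases "b = num_bars U i")
    case True
    have "\<not> lex_less (pp_tail i s) (pp_tail i v)" if "v \<in> U" for v
      using ex_bar_under[OF assms(1) that, of i] bar_index_less_iff[OF assms(1,4)]
        term_over_barD(2)[OF assms(1)] True by (metis not_less)
    then show ?thesis
      using height True s assms(3) by (auto simp: star_after_def)
  next
    case False
    then have "b + 1 \<in> {1..num_bars U i}"
      using s(2) by simp
    then obtain u where u: "term_over_bar U u i (b + 1)"
      using ex_term_over_bar[OF assms(1)] by blast
    have uU: "u \<in> U"
      using u term_over_barD(3) assms(1) by blast
    have less: "lex_less (pp_tail i s) (pp_tail i u)"
      using bar_index_less_iff[OF assms(1,4) u] by simp
    have "nm_height n U s i > 0 \<longleftrightarrow> pp_tail (Suc i) s = pp_tail (Suc i) u"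
    proof
      assume "nm_height n U s i > 0"
      then obtain v where v: "v \<in> U" "pp_tail (Suc i) s = pp_tail (Suc i) v"
        "lex_less (pp_tail i s) (pp_tail i v)"
        using height by blast
      obtain b' where b': "term_over_bar U v i b'"
        using ex_bar_under assms(1) v(1) by blast
      \<comment> \<open>The bar under \<open>v\<close> is to the right of bar \<open>b\<close>,
        hence not to the left of its successor.\<close>
      have "\<not> b' < b + 1"
        using bar_index_less_iff[OF assms(1,4) b'] v(3) by simp
      then have "\<not> lex_less (pp_tail i v) (pp_tail i u)"
        using bar_index_less_iff[OF assms(1) b' u] by simp
      then have "lex_less (pp_tail i u) (pp_tail i v) \<or> pp_tail i u = pp_tail i v"
        using lex.less_linear by blast
      then have "lex_le (pp_tail (Suc i) u) (pp_tail (Suc i) v)"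
        by (auto simp: pp_tail_eq_iff lex_le_def dest: lex_less_pp_tail_Suc)
      then show "pp_tail (Suc i) s = pp_tail (Suc i) u"
        using lex_less_pp_tail_Suc[OF less] v(2) lex.order.antisym by simp
    qed (use height less uU in blast)
    \<comment> \<open>The top row has no row below it, and its only star follows the last bar. This
      agrees with the height, since beyond \<open>n\<close> all tails coincide.\<close>
    moreover have "pp_tail (Suc i) s = pp_tail (Suc i) u" if "i = n"
    proof -
      have "u \<in> janet_class n U s i"
        using uU that by (simp add: janet_class_def)
      then show ?thesis
        using in_janet_class_iff[OF assms(2) s(3)] by metis
    qed
    ultimately show ?thesis
      using False s assms(3) same_bar_below_iff[OF assms(1,4) u] unfolding star_after_def
      by (metis atLeastAtMost_iff le_neq_implies_less not_gr_zero)
  qed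
qed

section \<open>Janet-like divisors\<close>

lemma single_pp_dvd_iff: "pp_dvd (Poly_Mapping.single i k) v \<longleftrightarrow> k \<le> pp_deg i v"
proof
  assume "k \<le> pp_deg i v"
  then have "v = Poly_Mapping.single i k + (v - Poly_Mapping.single i k)"
    by (intro poly_mapping_eqI) (auto simp: lookup_add lookup_minus lookup_single when_def)
  then show "pp_dvd (Poly_Mapping.single i k) v"
    unfolding pp_dvd_def by blast
qed (auto simp: pp_dvd_def lookup_add)

text \<open>The cofactor can only be \<open>w - s\<close>, and it is multiplicative iff none of its
  exponents reaches that of the corresponding nonmultiplicative power.\<close>

lemma janet_like_divisor_iff:
  assumes "s \<in> U" "w \<in> pps n"
  shows "janet_like_divisor n U s w \<longleftrightarrow> pp_dvd s w \<and>
    (\<forall>l\<in>{1..n}. nm_height n U s l > 0 \<longrightarrow> pp_deg l (w - s) < nm_exp n U s l)"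
proof -
  have "v \<in> pps n" if "w = s + v" for v
    using assms(2) that by (force simp: pps_def in_keys_iff lookup_add)
  moreover have "v \<in> M n U s \<longleftrightarrow>
      (\<forall>l\<in>{1..n}. nm_height n U s l > 0 \<longrightarrow> pp_deg l v < nm_exp n U s l)" if "v \<in> pps n" for v
  proof -
    have "v \<in> M n U s \<longleftrightarrow> (\<forall>w\<in>NMP n U s. \<not> pp_dvd w v)"
      using that by (simp add: M_def NM_def)
    also have "\<dots> \<longleftrightarrow> (\<forall>l\<in>{1..n}. nm_height n U s l > 0 \<longrightarrow>
        \<not> pp_dvd (Poly_Mapping.single l (nm_exp n U s l)) v)"
      unfolding NMP_def by blast
    finally show ?thesis
      by (simp add: single_pp_dvd_iff not_le)
  qed
  moreover have "w - s = v" if "w = s + v" for v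
    using that by simp
  ultimately show ?thesis
    using assms(1) unfolding janet_like_divisor_def pp_dvd_def by metis
qed

theorem theorem24:
  fixes n i j :: nat and U :: "pp set" and t s p :: pp
  assumes "finite U" and "U \<subseteq> pps n"
    and "t \<in> U"
    and "i \<in> {1..n}"
    and "p = Poly_Mapping.single i (nm_exp n U t i)" and "p \<in> NMP n U t"
    and "term_over_bar U t i j"
    and "s \<in> U"
  shows "janet_like_divisor n U s (p + t) \<longleftrightarrow>
    pp_dvd s (p + t) \<and>
    term_over_bar U s i (j + 1) \<and>
    (\<forall>j'\<in>{1..n}. pp_dvd (Poly_Mapping.single j' 1) (p + t - s) \<longrightarrow>
       (\<exists>b. term_over_bar U s j' b \<and> star_after n U j' b) \<or>
       (nm_height n U s j' > 0 \<and> nm_exp n U s j' > pp_deg j' (p + t - s)))"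
proof -
  define k where "k = nm_exp n U t i"
  have exp_pos: "nm_exp n U u l > 0" if "u \<in> U" "nm_height n U u l > 0" for u l
    using nm_exp_attained[OF assms(1) that] by (metis zero_less_diff)
  \<comment> \<open>Membership in \<open>NMP\<close> gives a positive height only for some index
    \<open>i'\<close>. As the exponent is positive, the power determines its variable, so
    \<open>i' = i\<close>.\<close>
  obtain i' where i': "p = Poly_Mapping.single i' (nm_exp n U t i')" "nm_height n U t i' > 0"
    using assms(6) by (auto simp: NMP_def)
  then have "pp_deg i' p \<noteq> 0"
    using exp_pos[OF assms(3)] by simp
  then have "i' = i"
    unfolding assms(5) by (simp add: lookup_single when_def split: if_splits)
  then have height: "nm_height n U t i > 0"
    using i'(2) by simp
  \<comment> \<open>\<open>v\<close> realises the minimal gap \<open>k\<close>, so multiplying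
    \<open>t\<close> by \<open>p\<close> raises the exponent of \<open>x_i\<close> exactly to that
    of \<open>v\<close>.\<close>
  obtain v where v: "v \<in> janet_class n U t i" "pp_deg i t < pp_deg i v" "k = pp_deg i v - pp_deg i t"
    using nm_exp_attained[OF assms(1,3) height] unfolding k_def by blast
  have vU: "v \<in> U" and v_tail: "pp_tail (Suc i) v = pp_tail (Suc i) t"
    using v(1) in_janet_class_iff[OF assms(2,3)] by auto
  have deg_pt: "pp_deg l (p + t) = (if l = i then pp_deg i v else pp_deg l t)" for l
    using v(2,3) by (simp add: assms(5) k_def[symmetric] lookup_add lookup_single when_def)
  have v_pt: "pp_deg l v = pp_deg l (p + t)" if "i \<le> l" for l
    using v_tail that by (auto simp: deg_pt pp_tail_eq_iff)
  have "t \<in> pps n"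
    using assms(2,3) by blast
  then have pt: "p + t \<in> pps n"
    using assms(4) keys_add[of p t] by (auto simp: pps_def assms(5) split: if_splits)
  have star: "(\<exists>b. term_over_bar U s l b \<and> star_after n U l b) \<longleftrightarrow> nm_height n U s l = 0"
    if "l \<in> {1..n}" for l
    using star_after_iff_nm_height[OF assms(1,2) that] ex_bar_under[OF assms(1,8)] by blast
  \<comment> \<open>The guard that \<open>x_j'\<close> divides the quotient is harmless: where the
    exponent is 0, it is below the nonmultiplicative exponent, which is positive whenever the height
    is.\<close>
  have cond3: "(\<forall>j'\<in>{1..n}. pp_dvd (Poly_Mapping.single j' 1) (p + t - s) \<longrightarrow>
       (\<exists>b. term_over_bar U s j' b \<and> star_after n U j' b) \<or>
       (nm_height n U s j' > 0 \<and> nm_exp n U s j' > pp_deg j' (p + t - s))) \<longleftrightarrow>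
    (\<forall>l\<in>{1..n}. nm_height n U s l > 0 \<longrightarrow> pp_deg l (p + t - s) < nm_exp n U s l)"
  proof (rule ball_cong[OF refl])
    fix l
    assume "l \<in> {1..n}"
    from star[OF this] show "(pp_dvd (Poly_Mapping.single l 1) (p + t - s) \<longrightarrow>
       (\<exists>b. term_over_bar U s l b \<and> star_after n U l b) \<or>
       (nm_height n U s l > 0 \<and> nm_exp n U s l > pp_deg l (p + t - s))) \<longleftrightarrow>
      (nm_height n U s l > 0 \<longrightarrow> pp_deg l (p + t - s) < nm_exp n U s l)"
      unfolding single_pp_dvd_iff using exp_pos[OF assms(8), of l]
      by (cases "pp_deg l (p + t - s) = 0") auto
  qed
  have "term_over_bar U s i (Suc j)"
    if dvd: "pp_dvd s (p + t)"
      and nm: "\<forall>l\<in>{1..n}. nm_height n U s l > 0 \<longrightarrow> pp_deg l (p + t - s) < nm_exp n U s l"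
  proof -
    have tail_s: "pp_tail i s = pp_tail i v"
    proof (rule ccontr)
      assume "pp_tail i s \<noteq> pp_tail i v"
      moreover have le: "pp_deg l s \<le> pp_deg l (p + t)" for l
        using dvd unfolding pp_dvd_def by (metis le_add1 lookup_add)
      \<comment> \<open>Divisibility bounds the exponents of \<open>s\<close> by those of
        \<open>pt\<close>, which from \<open>i\<close> on are those of \<open>v\<close>.\<close>
      then have "\<not> lex_less (pp_tail i v) (pp_tail i s)"
        unfolding lex_less_pp_tail_iff using v_pt by (metis not_le)
      ultimately obtain l where l: "i \<le> l" "pp_deg l s < pp_deg l v" "\<forall>m>l. pp_deg m s = pp_deg m v"
        using lex_less_total lex_less_pp_tail_iff by metis
      have cls: "v \<in> janet_class n U s l"
        using l(3) vU by (simp add: janet_class_def)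
      have "l \<in> Poly_Mapping.keys v"
        using l(2) by (simp add: in_keys_iff)
      then have "l \<in> {1..n}"
        using assms(2) vU unfolding pps_def by blast
      moreover have "nm_height n U s l > 0"
        using cls l(2) nm_height_pos_iff assms(1,8) by blast
      \<comment> \<open>At \<open>l\<close> the terms \<open>v\<close> and \<open>pt\<close> have
        the same exponent, so the gap from \<open>s\<close> to \<open>v\<close> is the exponent of
        \<open>x_l\<close> in the quotient.\<close>
      moreover have "nm_exp n U s l \<le> pp_deg l (p + t - s)"
        using nm_exp_le[OF assms(1) cls l(2)] v_pt[OF l(1)] by (simp add: lookup_minus)
      ultimately show False
        using nm by force
    qed
    show ?thesis
    proof (rule term_over_bar_Suc[OF assms(1,7,8)])
      show "lex_less (pp_tail i t) (pp_tail i s)"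
        using v(2) v_tail lex_less_pp_tail_iff_deg tail_s by metis
    next
      fix w
      assume w: "w \<in> U" "lex_less (pp_tail i t) (pp_tail i w)"
      show "\<not> lex_less (pp_tail i w) (pp_tail i s)"
      proof
        assume *: "lex_less (pp_tail i w) (pp_tail i s)"
        \<comment> \<open>\<open>w\<close> is squeezed between \<open>t\<close> and
          \<open>v\<close>, whose tails from \<open>Suc i\<close> on agree. It then lies in the
          class of \<open>t\<close> with a gap smaller than the minimal gap
          \<open>k\<close>.\<close>
        have w_tail: "pp_tail (Suc i) w = pp_tail (Suc i) t"
          using lex_less_pp_tail_Suc[OF w(2)] lex_less_pp_tail_Suc[of i w v] * tail_s v_tail
            lex.order.antisym by simp
        then have "pp_deg i t < pp_deg i w" "pp_deg i w < pp_deg i v"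
          using w(2) * tail_s v_tail lex_less_pp_tail_iff_deg by metis+
        moreover have "w \<in> janet_class n U t i"
          using w(1) w_tail in_janet_class_iff[OF assms(2,3)] by blast
        ultimately show False
          using nm_exp_le[OF assms(1), of w n t i] v(3) k_def by simp
      qed
    qed
  qed
  then show ?thesis
    unfolding cond3 janet_like_divisor_iff[OF assms(8) pt] by auto
qed

end
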